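(* Let $n\ge 2$. There are no entire $Q_{n-1}$-translators in $\mathbb{R}^{n+1}$ (with direction of translation $e_{n+1}$) such that their principal curvatures belong to $\Gamma_n$ at every point.
   Context: For $0\le l\le n$, $S_l(\lambda)$ denotes the elementary symmetric polynomial of order $l$ in $\lambda=(\lambda_1,\dots,\lambda_n)$ (with $S_0=1$), and $Q_k(\lambda)=S_{k+1}(\lambda)/S_k(\lambda)$ for $0\le k\le n-1$. The cone $\Gamma_n$ is $\{\lambda\in\mathbb{R}^n: S_l(\lambda)>0 \text{ for } l=0,\dots,n\}$. For a smooth hypersurface $M\subset\mathbb{R}^{n+1}$ with unit normal $\nu$, the second fundamental form is $h_{ij}=\langle D_{e_i}e_j,\nu\rangle$ and $\lambda$ is the vector of principal curvatures. $M$ is a $Q_k$-translator with direction $v\in\mathbb{S}^n$ if $Q_k(\lambda)=\langle\nu,v\rangle$ at every point of $M$. A hypersurface is entire if it is the graph $\{(x,u(x)):x\in\mathbb{R}^n\}$ of a smooth function $u$ defined on all of $\mathbb{R}^n$; for a graph, $\nu=(-Du,1)/\sqrt{1+|Du|^2}$ is the upward unit normal. *)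

theory Defs
  imports "HOL-Analysis.Analysis"
begin

text \<open>\<open>C\<^sup>k\<close> and smooth maps on an open set \<open>S\<close>: all iterated directional derivatives exist in the
  Frechet sense, and those of order \<open>k\<close> are continuous.\<close>

primrec Ck_on :: "nat \<Rightarrow> ('a::real_normed_vector \<Rightarrow> 'b::real_normed_vector) \<Rightarrow> 'a set \<Rightarrow> bool" where
  "Ck_on 0 f S \<longleftrightarrow> continuous_on S f"
| "Ck_on (Suc k) f S \<longleftrightarrow> (\<forall>x\<in>S. f differentiable (at x)) \<and>
     (\<forall>v. Ck_on k (\<lambda>x. frechet_derivative f (at x) v) S)"

definition smooth_on :: "'a set \<Rightarrow> ('a::real_normed_vector \<Rightarrow> 'b::real_normed_vector) \<Rightarrow> bool" where
  "smooth_on S f \<longleftrightarrow> (\<forall>k. Ck_on k f S)"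

definition partial_deriv :: "'n \<Rightarrow> (real^'n \<Rightarrow> 'b::real_normed_vector) \<Rightarrow> real^'n \<Rightarrow> 'b" where
  "partial_deriv i f x = frechet_derivative f (at x) (axis i 1)"

definition elem_sym :: "nat \<Rightarrow> real^'n \<Rightarrow> real" where
  "elem_sym l \<kappa> = (\<Sum>A | A \<subseteq> (UNIV :: 'n set) \<and> card A = l. \<Prod>i\<in>A. \<kappa> $ i)"

definition Q_curv :: "nat \<Rightarrow> real^'n \<Rightarrow> real" where
  "Q_curv k \<kappa> = elem_sym (k + 1) \<kappa> / elem_sym k \<kappa>"

definition Gamma_cone :: "(real^'n) set" where
  "Gamma_cone = {\<kappa>. \<forall>l\<le>CARD('n). elem_sym l \<kappa> > 0}"

text \<open>A hypersurface is given by a global parametrization \<open>F\<close> with a unit normal field \<open>N\<close> along it;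
  curvature quantities are expressed in the coordinate frame \<open>\<partial>\<^sub>i F\<close>, in which
  the ambient derivative of the \<open>j\<close>-th frame field along the \<open>i\<close>-th one is \<open>\<partial>\<^sub>i \<partial>\<^sub>j F\<close>.\<close>

definition unit_normal_field :: "(real^'n \<Rightarrow> 'e::real_inner) \<Rightarrow> (real^'n \<Rightarrow> 'e) \<Rightarrow> bool" where
  "unit_normal_field F N \<longleftrightarrow>
     (\<forall>x. norm (N x) = 1 \<and> (\<forall>i. partial_deriv i F x \<bullet> N x = 0))"

definition first_ff :: "(real^'n \<Rightarrow> 'e::real_inner) \<Rightarrow> real^'n \<Rightarrow> real^'n^'n" where
  "first_ff F x = (\<chi> i j. partial_deriv i F x \<bullet> partial_deriv j F x)"

definition second_ff ::
  "(real^'n \<Rightarrow> 'e::real_inner) \<Rightarrow> (real^'n \<Rightarrow> 'e) \<Rightarrow> real^'n \<Rightarrow> real^'n^'n" where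
  "second_ff F N x = (\<chi> i j. partial_deriv i (partial_deriv j F) x \<bullet> N x)"

definition shape_operator ::
  "(real^'n \<Rightarrow> 'e::real_inner) \<Rightarrow> (real^'n \<Rightarrow> 'e) \<Rightarrow> real^'n \<Rightarrow> real^'n^'n" where
  "shape_operator F N x = matrix_inv (first_ff F x) ** second_ff F N x"

text \<open>\<open>\<kappa>\<close> lists the eigenvalues of the shape operator with multiplicity, i.e. the roots of its
  characteristic polynomial. It is determined up to a permutation of its entries.\<close>

definition principal_curvatures ::
  "(real^'n \<Rightarrow> 'e::real_inner) \<Rightarrow> (real^'n \<Rightarrow> 'e) \<Rightarrow> real^'n \<Rightarrow> real^'n \<Rightarrow> bool" where
  "principal_curvatures F N x \<kappa> \<longleftrightarrow>
     (\<forall>t. det (mat t - shape_operator F N x) = (\<Prod>i\<in>UNIV. t - \<kappa> $ i))"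

definition Q_translator ::
  "nat \<Rightarrow> 'e::real_inner \<Rightarrow> (real^'n \<Rightarrow> 'e) \<Rightarrow> (real^'n \<Rightarrow> 'e) \<Rightarrow> bool" where
  "Q_translator k v F N \<longleftrightarrow> norm v = 1 \<and> unit_normal_field F N \<and>
     (\<forall>x. \<exists>\<kappa>. principal_curvatures F N x \<kappa> \<and> Q_curv k \<kappa> = N x \<bullet> v)"

text \<open>\<open>\<real>\<^bsup>n+1\<^esup>\<close> is the inner product space \<open>\<real>\<^sup>n \<times> \<real>\<close>, so that \<open>e\<^bsub>n+1\<^esub> = (0, 1)\<close>.\<close>

definition graph_param :: "(real^'n \<Rightarrow> real) \<Rightarrow> real^'n \<Rightarrow> (real^'n) \<times> real" where
  "graph_param u x = (x, u x)"

definition grad :: "(real^'n \<Rightarrow> real) \<Rightarrow> real^'n \<Rightarrow> real^'n" where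
  "grad u x = (\<chi> i. partial_deriv i u x)"

definition upward_normal :: "(real^'n \<Rightarrow> real) \<Rightarrow> real^'n \<Rightarrow> (real^'n) \<times> real" where
  "upward_normal u x = (1 / sqrt (1 + (norm (grad u x))\<^sup>2)) *\<^sub>R (- grad u x, 1)"

text \<open>The next two lemmas record that \<open>elem_sym\<close>, and hence \<open>Q_curv\<close> and \<open>Gamma_cone\<close>, do not depend
  on the choice of the vector of principal curvatures, and that the upward normal is a unit normal.\<close>

lemma elem_sym_unique:
  fixes \<kappa> \<mu> :: "real^'n"
  assumes "principal_curvatures F N x \<kappa>" "principal_curvatures F N x \<mu>"
  shows "elem_sym l \<kappa> = elem_sym l \<mu>"
proof (cases "l \<le> CARD('n)")
  case False
  then have *: "\<not> (A \<subseteq> (UNIV :: 'n set) \<and> card A = l)" for A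
    by (metis card_mono finite)
  have "{A. A \<subseteq> (UNIV :: 'n set) \<and> card A = l} = {}" using * by blast
  then show ?thesis unfolding elem_sym_def by simp
next
  case True
  have expand: "(\<Prod>i\<in>UNIV. t - \<kappa> $ i)
      = (\<Sum>k\<le>CARD('n). ((-1) ^ (CARD('n) - k) * elem_sym (CARD('n) - k) \<kappa>) * t ^ k)"
    for t and \<kappa> :: "real^'n"
  proof -
    let ?N = "CARD('n)"
    have "(\<Prod>i\<in>(UNIV::'n set). (- \<kappa> $ i) + t)
        = (\<Sum>B\<in>Pow UNIV. (\<Prod>i\<in>B. - \<kappa> $ i) * (\<Prod>i\<in>UNIV - B. t))"
      by (rule prod_add) simp
    also have "\<dots> = (\<Sum>B\<in>Pow (UNIV::'n set). (-1) ^ card B * (\<Prod>i\<in>B. \<kappa> $ i) * t ^ (?N - card B))"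
    proof (rule sum.cong[OF refl])
      fix B :: "'n set"
      have "(\<Prod>i\<in>B. - \<kappa> $ i) = (-1) ^ card B * (\<Prod>i\<in>B. \<kappa> $ i)"
        using prod.distrib[of "\<lambda>_. -1" "\<lambda>i. \<kappa> $ i" B] by simp
      then show "(\<Prod>i\<in>B. - \<kappa> $ i) * (\<Prod>i\<in>UNIV - B. t)
          = (-1) ^ card B * (\<Prod>i\<in>B. \<kappa> $ i) * t ^ (?N - card B)"
        by (simp add: card_Diff_subset)
    qed
    also have "\<dots> = (\<Sum>l\<le>?N. \<Sum>B | B \<in> Pow (UNIV::'n set) \<and> card B = l.
        (-1) ^ card B * (\<Prod>i\<in>B. \<kappa> $ i) * t ^ (?N - card B))"
      by (rule sum.group[symmetric]) (auto intro: card_mono)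
    also have "\<dots> = (\<Sum>l\<le>?N. ((-1) ^ l * elem_sym l \<kappa>) * t ^ (?N - l))"
      by (intro sum.cong refl)
        (auto simp: elem_sym_def sum_distrib_left sum_distrib_right intro!: sum.cong)
    also have "\<dots> = (\<Sum>k\<le>?N. ((-1) ^ (?N - k) * elem_sym (?N - k) \<kappa>) * t ^ k)"
      by (rule sum.reindex_bij_witness[of _ "\<lambda>k. ?N - k" "\<lambda>k. ?N - k"]) auto
    finally show ?thesis by simp
  qed
  have "\<forall>t. (\<Sum>k\<le>CARD('n). ((-1) ^ (CARD('n) - k) * elem_sym (CARD('n) - k) \<kappa>) * t ^ k)
      = (\<Sum>k\<le>CARD('n). ((-1) ^ (CARD('n) - k) * elem_sym (CARD('n) - k) \<mu>) * t ^ k)"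
    using assms unfolding principal_curvatures_def expand by simp
  then have "\<forall>k\<le>CARD('n). (-1) ^ (CARD('n) - k) * elem_sym (CARD('n) - k) \<kappa>
      = (-1) ^ (CARD('n) - k) * elem_sym (CARD('n) - k) \<mu>"
    unfolding polyfun_eq_coeffs .
  from this[rule_format, of "CARD('n) - l"] True show ?thesis by simp
qed

lemma unit_normal_field_upward_normal:
  assumes "\<And>x. u differentiable (at x)"
  shows "unit_normal_field (graph_param u) (upward_normal u)"
  unfolding unit_normal_field_def
proof (intro allI conjI)
  fix x
  have pos: "0 < sqrt (1 + (norm (grad u x))\<^sup>2)"
    by (simp add: add_pos_nonneg)
  have "norm (- grad u x, 1 :: real) = sqrt (1 + (norm (grad u x))\<^sup>2)"
    by (simp add: norm_Pair add.commute)
  with pos show "norm (upward_normal u x) = 1"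
    unfolding upward_normal_def norm_scaleR by simp
  fix i
  have der: "(u has_derivative frechet_derivative u (at x)) (at x)"
    using assms frechet_derivative_works by blast
  have "(graph_param u has_derivative (\<lambda>h. (h, frechet_derivative u (at x) h))) (at x)"
    using has_derivative_Pair[OF has_derivative_ident der] by (simp add: graph_param_def[abs_def])
  then have "frechet_derivative (graph_param u) (at x) = (\<lambda>h. (h, frechet_derivative u (at x) h))"
    by (rule frechet_derivative_at[symmetric])
  then have "partial_deriv i (graph_param u) x = (axis i 1, grad u x $ i)"
    by (simp add: partial_deriv_def grad_def)
  then have "partial_deriv i (graph_param u) x \<bullet> (- grad u x, 1) = 0"
    by (simp add: inner_axis')
  then show "partial_deriv i (graph_param u) x \<bullet> upward_normal u x = 0"
    unfolding upward_normal_def inner_scaleR_right by simp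
qed

end

theory Submission
  imports Defs
begin

text \<open>
  At a point of the graph with gradient \<open>p\<close> put \<open>W = sqrt (1 + |p|\<^sup>2)\<close>. In graph coordinates the first
  fundamental form is \<open>g = I + p p\<^sup>T\<close>, the second is \<open>h = D\<^sup>2u / W\<close>, and the translator equation reads
  \<open>S\<^sub>n / S\<^sub>n\<^sub>-\<^sub>1 = 1 / W\<close>, that is, the reciprocals of the principal curvatures add up to \<open>W\<close>. When all
  principal curvatures are positive, none of the reciprocals exceeds \<open>W\<close>, so every principal curvature
  is at least \<open>1 / W\<close> (\<open>Gamma_cone_pos\<close>, \<open>Q_curv_le_entry\<close>).

  The principal curvatures are the eigenvalues of \<open>h\<close> relative to \<open>g\<close>, and the smallest of them is the
  minimum of the Rayleigh quotient (\<open>least_relative_eigenvalue\<close>, which uses that the Hessian is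
  symmetric). Hence \<open>h \<ge> g / W\<close> as quadratic forms. The factor \<open>W\<close> cancels, leaving
  \<open>D\<^sup>2u \<ge> I + p p\<^sup>T\<close> everywhere (\<open>translator_pure_second_derivative_bound\<close>).

  On a coordinate line this is the ordinary differential inequality \<open>f'' \<ge> 1 + f'\<^sup>2\<close>, with equality for
  the grim reaper \<open>- ln (cos t)\<close>. It forces \<open>arctan f'\<close> to grow at least at unit speed, which is
  impossible on an interval of length \<open>\<pi>\<close> (\<open>no_global_Riccati_supersolution\<close>), whereas an entire \<open>u\<close>
  would give a solution on the whole line.
\<close>

section \<open>Symmetry of second derivatives\<close>

lemma has_real_derivative_along_line:
  fixes f :: "'a::real_normed_vector \<Rightarrow> real"
  assumes "f differentiable (at (x + s *\<^sub>R v))"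
  shows "((\<lambda>s. f (x + s *\<^sub>R v)) has_real_derivative frechet_derivative f (at (x + s *\<^sub>R v)) v) (at s)"
proof -
  have f: "(f has_derivative frechet_derivative f (at (x + s *\<^sub>R v))) (at (x + s *\<^sub>R v))"
    using assms frechet_derivative_works by blast
  have line: "((\<lambda>s. x + s *\<^sub>R v) has_derivative (\<lambda>h. h *\<^sub>R v)) (at s)"
    by (auto intro!: derivative_eq_intros)
  have "((\<lambda>s. f (x + s *\<^sub>R v)) has_derivative
      (\<lambda>h. frechet_derivative f (at (x + s *\<^sub>R v)) (h *\<^sub>R v))) (at s)"
    by (rule has_derivative_compose[OF line f])
  moreover have "frechet_derivative f (at (x + s *\<^sub>R v)) (h *\<^sub>R v)
      = frechet_derivative f (at (x + s *\<^sub>R v)) v * h" for h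
    using linear_cmul[OF linear_frechet_derivative[OF assms]] by simp
  ultimately show ?thesis by (simp add: has_field_derivative_def)
qed

text \<open>The mean value theorem, applied first in direction \<open>v\<close> to the difference of \<open>u\<close> over a step in
  direction \<open>w\<close>, then in direction \<open>w\<close> to the derivative along \<open>v\<close>.\<close>

lemma second_difference_mean_value:
  fixes u :: "'a::real_normed_vector \<Rightarrow> real"
  assumes u: "\<And>x. u differentiable (at x)"
    and dv: "\<And>x. (\<lambda>x. frechet_derivative u (at x) v) differentiable (at x)"
    and t: "0 < t"
  obtains \<xi> \<eta> where "0 < \<xi>" "\<xi> < t" "0 < \<eta>" "\<eta> < t"
    "u (x + t *\<^sub>R v + t *\<^sub>R w) - u (x + t *\<^sub>R v) - u (x + t *\<^sub>R w) + u x
      = t * t * frechet_derivative (\<lambda>x. frechet_derivative u (at x) v) (at (x + \<xi> *\<^sub>R v + \<eta> *\<^sub>R w)) w"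
proof -
  let ?d = "\<lambda>x. frechet_derivative u (at x) v"
  let ?g = "\<lambda>s. u ((x + t *\<^sub>R w) + s *\<^sub>R v) - u (x + s *\<^sub>R v)"
  have "\<exists>\<xi>>0. \<xi> < t \<and> ?g t - ?g 0 = (t - 0) * (?d ((x + t *\<^sub>R w) + \<xi> *\<^sub>R v) - ?d (x + \<xi> *\<^sub>R v))"
    by (rule MVT2[OF t]) (intro DERIV_diff has_real_derivative_along_line u)
  then obtain \<xi> where \<xi>: "0 < \<xi>" "\<xi> < t"
    "?g t - ?g 0 = t * (?d ((x + t *\<^sub>R w) + \<xi> *\<^sub>R v) - ?d (x + \<xi> *\<^sub>R v))" by auto
  let ?k = "\<lambda>s. ?d ((x + \<xi> *\<^sub>R v) + s *\<^sub>R w)"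
  have "\<exists>\<eta>>0. \<eta> < t \<and> ?k t - ?k 0 = (t - 0) * frechet_derivative ?d (at ((x + \<xi> *\<^sub>R v) + \<eta> *\<^sub>R w)) w"
    by (rule MVT2[OF t]) (intro has_real_derivative_along_line dv)
  then obtain \<eta> where \<eta>: "0 < \<eta>" "\<eta> < t"
    "?k t - ?k 0 = t * frechet_derivative ?d (at ((x + \<xi> *\<^sub>R v) + \<eta> *\<^sub>R w)) w" by auto
  have "u (x + t *\<^sub>R v + t *\<^sub>R w) - u (x + t *\<^sub>R v) - u (x + t *\<^sub>R w) + u x = ?g t - ?g 0"
    by (simp add: algebra_simps)
  also have "\<dots> = t * (?k t - ?k 0)"
    unfolding \<xi>(3) by (simp add: add_ac)
  also have "\<dots> = t * t * frechet_derivative ?d (at (x + \<xi> *\<^sub>R v + \<eta> *\<^sub>R w)) w"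
    unfolding \<eta>(3) by simp
  finally show thesis using that \<xi> \<eta> by blast
qed

text \<open>Both mixed derivatives are limits of the same second difference quotient, which is symmetric
  in the two directions.\<close>

lemma second_derivative_symmetric:
  fixes u :: "'a::real_normed_vector \<Rightarrow> real"
  assumes C2: "Ck_on 2 u UNIV"
  shows "frechet_derivative (\<lambda>x. frechet_derivative u (at x) v) (at x) w
       = frechet_derivative (\<lambda>x. frechet_derivative u (at x) w) (at x) v"
proof -
  let ?D = "\<lambda>v w x. frechet_derivative (\<lambda>x. frechet_derivative u (at x) v) (at x) w"
  have u: "\<And>x. u differentiable (at x)"
    and d: "\<And>v x. (\<lambda>x. frechet_derivative u (at x) v) differentiable (at x)"
    and cont: "\<And>v w. continuous_on UNIV (?D v w)"
    using C2 by (simp_all add: numeral_2_eq_2)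
  define close where "close e v w t \<longleftrightarrow> (\<forall>\<xi> \<eta>. 0 < \<xi> \<longrightarrow> \<xi> < t \<longrightarrow> 0 < \<eta> \<longrightarrow> \<eta> < t \<longrightarrow>
      \<bar>?D v w (x + \<xi> *\<^sub>R v + \<eta> *\<^sub>R w) - ?D v w x\<bar> < e)" for e v w and t :: real
  have close: "\<exists>\<delta>>0. \<forall>t. 0 < t \<longrightarrow> t < \<delta> \<longrightarrow> close e v w t" if "0 < e" for e v w
  proof -
    have "\<exists>r>0. \<forall>y. dist y x < r \<longrightarrow> dist (?D v w y) (?D v w x) < e"
      using cont[of v w] \<open>0 < e\<close> unfolding continuous_on_iff by auto
    then obtain r where "r > 0" and r: "\<And>y. dist y x < r \<Longrightarrow> dist (?D v w y) (?D v w x) < e"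
      by blast
    show ?thesis
      unfolding close_def
    proof (intro exI[of _ "r / (norm v + norm w + 1)"] conjI allI impI)
      show "0 < r / (norm v + norm w + 1)" using \<open>r > 0\<close> by (simp add: add_nonneg_pos)
      fix t \<xi> \<eta> :: real
      assume t: "0 < t" "t < r / (norm v + norm w + 1)" and \<xi>: "0 < \<xi>" "\<xi> < t" and \<eta>: "0 < \<eta>" "\<eta> < t"
      have "dist (x + \<xi> *\<^sub>R v + \<eta> *\<^sub>R w) x = norm (\<xi> *\<^sub>R v + \<eta> *\<^sub>R w)"
        by (simp add: dist_norm)
      also have "\<dots> \<le> \<xi> * norm v + \<eta> * norm w"
        using norm_triangle_ineq[of "\<xi> *\<^sub>R v" "\<eta> *\<^sub>R w"] \<xi> \<eta> by simp
      also have "\<dots> \<le> t * norm v + t * norm w"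
        using \<xi> \<eta> by (intro add_mono mult_right_mono) auto
      also have "\<dots> < t * (norm v + norm w + 1)" using t by (simp add: algebra_simps)
      also have "\<dots> < r" using t(2) by (subst (asm) pos_less_divide_eq) (auto intro: add_nonneg_pos)
      finally show "\<bar>?D v w (x + \<xi> *\<^sub>R v + \<eta> *\<^sub>R w) - ?D v w x\<bar> < e"
        using r by (simp add: dist_real_def)
    qed
  qed
  have "\<bar>?D v w x - ?D w v x\<bar> \<le> e" if "0 < e" for e
  proof -
    from that have "0 < e / 2" by simp
    from close[OF this, of v w] obtain \<delta>
      where \<delta>: "\<delta> > 0" "\<And>t. 0 < t \<Longrightarrow> t < \<delta> \<Longrightarrow> close (e / 2) v w t" by blast
    from close[OF \<open>0 < e / 2\<close>, of w v] obtain \<delta>'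
      where \<delta>': "\<delta>' > 0" "\<And>t. 0 < t \<Longrightarrow> t < \<delta>' \<Longrightarrow> close (e / 2) w v t" by blast
    obtain t where t: "0 < t" "t < \<delta>" "t < \<delta>'"
      using field_lbound_gt_zero[OF \<delta>(1) \<delta>'(1)] by auto
    obtain \<xi> \<eta> where 1: "0 < \<xi>" "\<xi> < t" "0 < \<eta>" "\<eta> < t"
      "u (x + t *\<^sub>R v + t *\<^sub>R w) - u (x + t *\<^sub>R v) - u (x + t *\<^sub>R w) + u x
        = t * t * ?D v w (x + \<xi> *\<^sub>R v + \<eta> *\<^sub>R w)"
      by (rule second_difference_mean_value[OF u d t(1)])
    obtain \<xi>' \<eta>' where 2: "0 < \<xi>'" "\<xi>' < t" "0 < \<eta>'" "\<eta>' < t"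
      "u (x + t *\<^sub>R w + t *\<^sub>R v) - u (x + t *\<^sub>R w) - u (x + t *\<^sub>R v) + u x
        = t * t * ?D w v (x + \<xi>' *\<^sub>R w + \<eta>' *\<^sub>R v)"
      by (rule second_difference_mean_value[OF u d t(1)])
    have "x + t *\<^sub>R w + t *\<^sub>R v = x + t *\<^sub>R v + t *\<^sub>R w" by (simp add: add_ac)
    then have "u (x + t *\<^sub>R w + t *\<^sub>R v) = u (x + t *\<^sub>R v + t *\<^sub>R w)" by (rule arg_cong)
    with 1(5) 2(5) have "t * t * ?D v w (x + \<xi> *\<^sub>R v + \<eta> *\<^sub>R w)
        = t * t * ?D w v (x + \<xi>' *\<^sub>R w + \<eta>' *\<^sub>R v)" by linarith
    then have "?D v w (x + \<xi> *\<^sub>R v + \<eta> *\<^sub>R w) = ?D w v (x + \<xi>' *\<^sub>R w + \<eta>' *\<^sub>R v)"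
      using t(1) by simp
    moreover have "\<bar>?D v w (x + \<xi> *\<^sub>R v + \<eta> *\<^sub>R w) - ?D v w x\<bar> < e / 2"
      using \<delta>(2)[OF t(1,2)] 1(1-4) by (simp add: close_def)
    moreover have "\<bar>?D w v (x + \<xi>' *\<^sub>R w + \<eta>' *\<^sub>R v) - ?D w v x\<bar> < e / 2"
      using \<delta>'(2)[OF t(1,3)] 2(1-4) by (simp add: close_def)
    ultimately show ?thesis by linarith
  qed
  then have "\<bar>?D v w x - ?D w v x\<bar> \<le> 0" by (rule field_le_epsilon) simp
  then show ?thesis by simp
qed

section \<open>The smallest relative eigenvalue of a pair of quadratic forms\<close>

lemma symmetric_matrix_inner:
  fixes M :: "real^'n^'n"
  assumes "transpose M = M"
  shows "x \<bullet> (M *v y) = y \<bullet> (M *v x)"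
  by (metis assms dot_lmul_matrix inner_commute transpose_matrix_vector)

text \<open>If \<open>M y\<close> were nonzero, moving from \<open>y\<close> against it would bring the form below its minimum \<open>0\<close>.\<close>

lemma psd_isotropic_in_kernel:
  fixes M :: "real^'n^'n"
  assumes sym: "transpose M = M" and psd: "\<And>z. 0 \<le> z \<bullet> (M *v z)" and y: "y \<bullet> (M *v y) = 0"
  shows "M *v y = 0"
proof (rule ccontr)
  let ?w = "M *v y"
  let ?c = "?w \<bullet> (M *v ?w)"
  \<comment> \<open>Any step \<open>t\<close> with \<open>0 < t\<close> and \<open>t c < 2 |w|\<^sup>2\<close> would do; the \<open>+ 1\<close> covers \<open>c = 0\<close>.\<close>
  let ?t = "(?w \<bullet> ?w) / (?c + 1)"
  assume "?w \<noteq> 0"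
  then have w: "0 < ?w \<bullet> ?w" by simp
  have c: "0 \<le> ?c" by (rule psd)
  have t: "0 < ?t" using w c by simp
  have tc: "?t * ?c \<le> ?w \<bullet> ?w"
    using w c by (simp add: field_simps)
  have "0 \<le> (y - ?t *\<^sub>R ?w) \<bullet> (M *v (y - ?t *\<^sub>R ?w))" by (rule psd)
  also have "\<dots> = y \<bullet> (M *v y) - ?t * (y \<bullet> (M *v ?w)) - ?t * (?w \<bullet> ?w) + ?t * ?t * ?c"
    by (simp add: algebra_simps)
  also have "y \<bullet> (M *v ?w) = ?w \<bullet> ?w" by (rule symmetric_matrix_inner[OF sym])
  also have "y \<bullet> (M *v y) - ?t * (?w \<bullet> ?w) - ?t * (?w \<bullet> ?w) + ?t * ?t * ?c
      = ?t * (?t * ?c - 2 * (?w \<bullet> ?w))"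
    using y by (simp add: algebra_simps)
  finally have "0 \<le> ?t * ?c - 2 * (?w \<bullet> ?w)" using t by (simp only: zero_le_mult_iff) linarith
  with tc w show False by linarith
qed

text \<open>The minimum of the Rayleigh quotient is an eigenvalue of \<open>h\<close> relative to \<open>g\<close>, attained at an
  eigenvector.\<close>

lemma least_relative_eigenvalue:
  fixes g h :: "real^'n^'n"
  assumes sg: "transpose g = g" and sh: "transpose h = h"
    and pos: "\<And>z. z \<noteq> 0 \<Longrightarrow> 0 < z \<bullet> (g *v z)"
  obtains \<mu> y where "y \<noteq> 0" "h *v y = \<mu> *\<^sub>R (g *v y)"
    "\<And>z. \<mu> * (z \<bullet> (g *v z)) \<le> z \<bullet> (h *v z)"
proof -
  let ?R = "\<lambda>z. (z \<bullet> (h *v z)) / (z \<bullet> (g *v z))"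
  have "z \<bullet> (g *v z) \<noteq> 0" if "z \<in> sphere 0 1" for z
    using pos[of z] that by force
  then have "continuous_on (sphere 0 1) ?R"
    by (intro continuous_intros) auto
  moreover have "axis undefined 1 \<in> (sphere 0 1 :: (real^'n) set)" by simp
  ultimately obtain y where y: "y \<in> sphere 0 1" and min: "\<And>z. z \<in> sphere 0 1 \<Longrightarrow> ?R y \<le> ?R z"
    using continuous_attains_inf[OF compact_sphere, of 0 1 ?R] by blast
  from y have "y \<noteq> 0" by auto
  define \<mu> where "\<mu> = ?R y"
  \<comment> \<open>The quotient is invariant under scaling, so the minimum over the sphere is a global one.\<close>
  have ineq: "\<mu> * (z \<bullet> (g *v z)) \<le> z \<bullet> (h *v z)" for z
  proof (cases "z = 0")
    case False
    let ?z = "(1 / norm z) *\<^sub>R z"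
    have "\<mu> \<le> ?R ?z" unfolding \<mu>_def using False by (intro min) simp
    also have "?R ?z = ?R z" using False by (simp add: matrix_vector_mult_scaleR)
    finally show ?thesis using pos[OF False] by (simp add: pos_le_divide_eq)
  qed simp
  \<comment> \<open>Thus the form of \<open>h - \<mu> g\<close> is nonnegative and vanishes at \<open>y\<close>.\<close>
  let ?M = "h - \<mu> *\<^sub>R g"
  have M: "?M *v z = h *v z - \<mu> *\<^sub>R (g *v z)" for z
    by (simp add: matrix_vector_mult_diff_rdistrib scaleR_matrix_vector_assoc)
  have "?M *v y = 0"
  proof (rule psd_isotropic_in_kernel)
    show "transpose ?M = ?M" using sg sh by (simp add: transpose_def vec_eq_iff)
    show "0 \<le> z \<bullet> (?M *v z)" for z using ineq[of z] by (simp add: M inner_diff_right)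
    show "y \<bullet> (?M *v y) = 0" 
      unfolding M using pos[OF \<open>y \<noteq> 0\<close>] by (simp add: inner_diff_right \<mu>_def)
  qed
  then have "h *v y = \<mu> *\<^sub>R (g *v y)" by (simp add: M)
  with \<open>y \<noteq> 0\<close> ineq show thesis using that by blast
qed

section \<open>Principal curvatures in the positive cone\<close>

text \<open>The values \<open>S\<^sub>l(\<kappa>)\<close> are the coefficients of the polynomial \<open>\<Prod>\<^sub>j (t + \<kappa>\<^sub>j)\<close>. When they are all
  positive this polynomial has no root \<open>t \<ge> 0\<close>, but each \<open>- \<kappa>\<^sub>i\<close> is a root.\<close>

lemma Gamma_cone_pos:
  fixes \<kappa> :: "real^'n"
  assumes "\<kappa> \<in> Gamma_cone"
  shows "0 < \<kappa> $ i"
proof (rule ccontr)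
  assume "\<not> 0 < \<kappa> $ i"
  define t where "t = - \<kappa> $ i"
  have t: "0 \<le> t" using \<open>\<not> 0 < \<kappa> $ i\<close> by (simp add: t_def)
  have S: "0 < elem_sym l \<kappa>" if "l \<le> CARD('n)" for l
    using assms that by (simp add: Gamma_cone_def)
  have "0 = (\<Prod>j\<in>(UNIV::'n set). \<kappa> $ j + t)" by (rule sym, rule prod_zero) (auto simp: t_def)
  also have "\<dots> = (\<Sum>B\<in>Pow UNIV. (\<Prod>i\<in>B. \<kappa> $ i) * (\<Prod>i\<in>UNIV - B. t))"
    by (rule prod_add) simp
  also have "\<dots> = (\<Sum>B\<in>Pow (UNIV::'n set). (\<Prod>i\<in>B. \<kappa> $ i) * t ^ (CARD('n) - card B))"
    by (simp add: card_Diff_subset)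
  also have "\<dots> = (\<Sum>l\<le>CARD('n). \<Sum>B | B \<in> Pow (UNIV::'n set) \<and> card B = l.
      (\<Prod>i\<in>B. \<kappa> $ i) * t ^ (CARD('n) - card B))"
    by (rule sum.group[symmetric]) (auto intro: card_mono)
  also have "\<dots> = (\<Sum>l\<le>CARD('n). elem_sym l \<kappa> * t ^ (CARD('n) - l))"
    by (intro sum.cong refl) (auto simp: elem_sym_def sum_distrib_right intro!: sum.cong)
  also have "\<dots> > 0"
  proof (rule sum_pos2[of _ "CARD('n)"])
    show "0 \<le> elem_sym l \<kappa> * t ^ (CARD('n) - l)" if "l \<in> {..CARD('n)}" for l
      using S[of l] t that by (simp add: less_imp_le)
  qed (simp_all add: S)
  finally show False by simp
qed

text \<open>The summand of \<open>S\<^sub>n\<^sub>-\<^sub>1\<close> that omits the index \<open>i\<close> is \<open>S\<^sub>n / \<kappa>\<^sub>i\<close>, and the other summands are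
  nonnegative.\<close>

lemma Q_curv_le_entry:
  fixes \<kappa> :: "real^'n"
  assumes pos: "\<And>i. 0 < \<kappa> $ i"
  shows "Q_curv (CARD('n) - 1) \<kappa> \<le> \<kappa> $ i"
proof -
  let ?N = "CARD('n)"
  have N: "?N - 1 + 1 = ?N" using zero_less_card_finite[where 'a='n] by linarith
  have "{A. A \<subseteq> (UNIV :: 'n set) \<and> card A = ?N} = {UNIV}"
    by (metis (mono_tags, lifting) Collect_cong card_subset_eq finite singleton_conv subset_UNIV)
  then have top: "elem_sym ?N \<kappa> = (\<Prod>j\<in>UNIV. \<kappa> $ j)" by (simp add: elem_sym_def)
  have "(\<Prod>j\<in>UNIV - {i}. \<kappa> $ j) \<le> elem_sym (?N - 1) \<kappa>"
    unfolding elem_sym_def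
    by (rule member_le_sum) (auto intro!: prod_nonneg simp: less_imp_le[OF pos])
  then have "(\<Prod>j\<in>UNIV. \<kappa> $ j) \<le> \<kappa> $ i * elem_sym (?N - 1) \<kappa>"
    using pos[of i] by (subst prod.remove[of _ i]) auto
  moreover have "0 < elem_sym (?N - 1) \<kappa>"
    using \<open>(\<Prod>j\<in>UNIV - {i}. \<kappa> $ j) \<le> elem_sym (?N - 1) \<kappa>\<close> pos
    by (meson less_le_trans prod_pos)
  ultimately show ?thesis
    unfolding Q_curv_def N top by (simp add: pos_divide_le_eq)
qed

section \<open>Geometry of graphs\<close>

lemma partial_deriv_graph_param:
  assumes "u differentiable (at x)"
  shows "partial_deriv i (graph_param u) x = (axis i 1, partial_deriv i u x)"
proof -
  have "(u has_derivative frechet_derivative u (at x)) (at x)"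
    using assms frechet_derivative_works by blast
  from has_derivative_Pair[OF has_derivative_ident this]
  have "frechet_derivative (graph_param u) (at x) = (\<lambda>h. (h, frechet_derivative u (at x) h))"
    by (intro frechet_derivative_at[symmetric]) (simp add: graph_param_def[abs_def])
  then show ?thesis by (simp add: partial_deriv_def)
qed

lemma second_partial_deriv_graph_param:
  assumes "\<And>x. u differentiable (at x)" and d: "partial_deriv j u differentiable (at x)"
  shows "partial_deriv i (partial_deriv j (graph_param u)) x = (0, partial_deriv i (partial_deriv j u) x)"
proof -
  have "(partial_deriv j u has_derivative frechet_derivative (partial_deriv j u) (at x)) (at x)"
    using d frechet_derivative_works by blast
  from has_derivative_Pair[OF has_derivative_const this]
  have "frechet_derivative (partial_deriv j (graph_param u)) (at x)
      = (\<lambda>h. (0, frechet_derivative (partial_deriv j u) (at x) h))"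
    by (intro frechet_derivative_at[symmetric])
      (simp add: partial_deriv_graph_param[OF assms(1), abs_def])
  then show ?thesis by (simp add: partial_deriv_def)
qed

lemma first_ff_graph_param:
  assumes "u differentiable (at x)"
  shows "first_ff (graph_param u) x
    = (\<chi> i j. (if i = j then 1 else 0) + partial_deriv i u x * partial_deriv j u x)"
  by (simp add: first_ff_def partial_deriv_graph_param[OF assms] inner_axis_axis vec_eq_iff)

text \<open>The quadratic form of \<open>I + p p\<^sup>T\<close>, where \<open>p\<close> is the gradient.\<close>

lemma first_ff_graph_param_form:
  assumes "u differentiable (at x)"
  shows "z \<bullet> (first_ff (graph_param u) x *v z) = z \<bullet> z + (grad u x \<bullet> z)\<^sup>2"
proof -
  have "(first_ff (graph_param u) x *v z) = z + (grad u x \<bullet> z) *\<^sub>R grad u x"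
  proof (subst vec_eq_iff, intro allI)
    fix i
    have "(first_ff (graph_param u) x *v z) $ i
        = (\<Sum>j\<in>UNIV. (if i = j then z $ j else 0) + partial_deriv i u x * (partial_deriv j u x * z $ j))"
      by (auto simp: first_ff_graph_param[OF assms] matrix_vector_mult_def algebra_simps intro!: sum.cong)
    also have "\<dots> = z $ i + partial_deriv i u x * (\<Sum>j\<in>UNIV. partial_deriv j u x * z $ j)"
      by (simp add: sum.distrib sum_distrib_left)
    finally show "(first_ff (graph_param u) x *v z) $ i = (z + (grad u x \<bullet> z) *\<^sub>R grad u x) $ i"
      by (simp add: grad_def inner_vec_def mult.commute)
  qed
  then show ?thesis by (simp add: inner_add_right power2_eq_square inner_commute)
qed

lemma second_ff_graph_param:
  assumes "\<And>x. u differentiable (at x)" and "\<And>j. partial_deriv j u differentiable (at x)"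
  shows "second_ff (graph_param u) (upward_normal u) x
    = (\<chi> i j. partial_deriv i (partial_deriv j u) x / sqrt (1 + (norm (grad u x))\<^sup>2))"
  by (simp add: second_ff_def second_partial_deriv_graph_param[OF assms] upward_normal_def)

text \<open>Multiplying \<open>h y = \<mu> g y\<close> by the inverse of \<open>g\<close> gives an eigenvector of the shape operator, so \<open>\<mu>\<close> is
  a root of its characteristic polynomial.\<close>

lemma relative_eigenvalue_is_principal_curvature:
  assumes pos: "\<And>z. z \<noteq> 0 \<Longrightarrow> 0 < z \<bullet> (first_ff F x *v z)"
    and y: "y \<noteq> 0" "second_ff F N x *v y = \<mu> *\<^sub>R (first_ff F x *v y)"
    and \<kappa>: "principal_curvatures F N x \<kappa>"
  shows "\<exists>i. \<mu> = \<kappa> $ i"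
proof -
  let ?g = "first_ff F x" and ?A = "shape_operator F N x"
  have "\<forall>z. ?g *v z = 0 \<longrightarrow> z = 0" using pos by (metis inner_zero_right less_irrefl)
  then have "invertible ?g"
    by (metis invertible_left_inverse matrix_left_invertible_ker)
  then have "matrix_inv ?g ** ?g = mat 1"
    unfolding invertible_def matrix_inv_def by (rule someI2_ex) simp
  then have "?A *v y = \<mu> *\<^sub>R y"
    unfolding shape_operator_def
    by (simp add: y(2) matrix_vector_mul_assoc[symmetric] matrix_vector_mult_scaleR)
      (simp add: matrix_vector_mul_assoc)
  then have "(mat \<mu> - ?A) *v y = 0"
    by (simp add: matrix_vector_mult_diff_rdistrib)
      (simp add: vec_eq_iff matrix_vector_mult_def mat_def if_distrib if_distribR cong: if_cong)
  with y(1) have "\<not> invertible (mat \<mu> - ?A)"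
    by (metis invertible_left_inverse matrix_left_invertible_ker)
  then have "det (mat \<mu> - ?A) = 0" by (simp add: invertible_det_nz)
  then have "(\<Prod>i\<in>UNIV. \<mu> - \<kappa> $ i) = 0" using \<kappa> by (simp add: principal_curvatures_def)
  then show ?thesis by simp
qed

text \<open>The diagonal entries of the matrix inequality \<open>D\<^sup>2u \<ge> I + p p\<^sup>T\<close>: the least principal curvature is at
  least \<open>1 / W\<close>, so \<open>h \<ge> g / W\<close>, and \<open>h = D\<^sup>2u / W\<close>.\<close>

lemma translator_pure_second_derivative_bound:
  fixes u :: "real^'n \<Rightarrow> real"
  assumes smooth: "smooth_on UNIV u"
    and trans: "Q_translator (CARD('n) - 1) (0, 1) (graph_param u) (upward_normal u)"
    and cone: "\<exists>\<kappa>. principal_curvatures (graph_param u) (upward_normal u) x \<kappa> \<and> \<kappa> \<in> Gamma_cone"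
  shows "1 + (partial_deriv k u x)\<^sup>2 \<le> partial_deriv k (partial_deriv k u) x"
proof -
  let ?F = "graph_param u" and ?\<nu> = "upward_normal u"
  let ?g = "first_ff ?F x" and ?h = "second_ff ?F ?\<nu> x"
  define W where "W = sqrt (1 + (norm (grad u x))\<^sup>2)"
  have W: "0 < W" by (simp add: W_def add_pos_nonneg)
  have C2: "Ck_on 2 u UNIV" using smooth by (simp add: smooth_on_def)
  then have u: "\<And>x. u differentiable (at x)"
    and d: "\<And>j x. partial_deriv j u differentiable (at x)"
    by (simp_all add: numeral_2_eq_2 partial_deriv_def[abs_def])
  have h: "?h = (\<chi> i j. partial_deriv i (partial_deriv j u) x / W)"
    unfolding W_def by (rule second_ff_graph_param[OF u d])
  have pos: "0 < z \<bullet> (?g *v z)" if "z \<noteq> 0" for z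
    unfolding first_ff_graph_param_form[OF u] using that by (intro add_pos_nonneg) auto
  have sg: "transpose ?g = ?g"
    by (simp add: transpose_def first_ff_def inner_commute)
  have "partial_deriv i (partial_deriv j u) x = partial_deriv j (partial_deriv i u) x" for i j
    using second_derivative_symmetric[OF C2, of "axis j 1" x "axis i 1"]
    by (simp add: partial_deriv_def[abs_def])
  then have sh: "transpose ?h = ?h" by (simp add: transpose_def h)
  obtain \<mu> y where y: "y \<noteq> 0" "?h *v y = \<mu> *\<^sub>R (?g *v y)"
    and least: "\<And>z. \<mu> * (z \<bullet> (?g *v z)) \<le> z \<bullet> (?h *v z)"
    using least_relative_eigenvalue[OF sg sh pos] by metis
  obtain \<kappa> where \<kappa>: "principal_curvatures ?F ?\<nu> x \<kappa>" and "\<kappa> \<in> Gamma_cone"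
    using cone by blast
  obtain i where \<mu>: "\<mu> = \<kappa> $ i"
    using relative_eigenvalue_is_principal_curvature[OF pos y \<kappa>] by blast
  \<comment> \<open>The translator equation may be witnessed by another ordering of the principal curvatures.\<close>
  obtain \<kappa>' where \<kappa>': "principal_curvatures ?F ?\<nu> x \<kappa>'"
    "Q_curv (CARD('n) - 1) \<kappa>' = ?\<nu> x \<bullet> (0, 1)"
    using trans by (auto simp: Q_translator_def)
  have "Q_curv (CARD('n) - 1) \<kappa> = Q_curv (CARD('n) - 1) \<kappa>'"
    unfolding Q_curv_def using elem_sym_unique[OF \<kappa> \<kappa>'(1)] by simp
  also have "\<dots> = 1 / W" using \<kappa>'(2) by (simp add: upward_normal_def W_def)
  finally have "1 / W \<le> \<mu>"
    unfolding \<mu> using Q_curv_le_entry[of \<kappa> i] Gamma_cone_pos[OF \<open>\<kappa> \<in> Gamma_cone\<close>] by simp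
  moreover have "axis k 1 \<bullet> (?g *v axis k 1) = 1 + (partial_deriv k u x)\<^sup>2"
    unfolding first_ff_graph_param_form[OF u] by (simp add: inner_axis_axis inner_axis grad_def)
  moreover have "axis k 1 \<bullet> (?h *v axis k 1) = partial_deriv k (partial_deriv k u) x / W"
    by (simp add: inner_axis' matrix_vector_mult_basis column_def h)
  ultimately have "1 / W \<le> \<mu>"
    and "\<mu> * (1 + (partial_deriv k u x)\<^sup>2) \<le> partial_deriv k (partial_deriv k u) x / W"
    using least[of "axis k 1"] by simp_all
  moreover from this(1) have "1 / W * (1 + (partial_deriv k u x)\<^sup>2) \<le> \<mu> * (1 + (partial_deriv k u x)\<^sup>2)"
    by (rule mult_right_mono) simp
  ultimately have "(1 + (partial_deriv k u x)\<^sup>2) / W \<le> partial_deriv k (partial_deriv k u) x / W"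
    by simp
  then show ?thesis using W by (simp add: divide_le_cancel)
qed

section \<open>Finite lifespan of the one-dimensional inequality\<close>

text \<open>If \<open>v' \<ge> 1 + v\<^sup>2\<close> everywhere, then \<open>arctan v - t\<close> is nondecreasing, so \<open>arctan v\<close> gains at least
  \<open>\<pi>\<close> over an interval of length \<open>\<pi>\<close>. Its range is an open interval of exactly that length.\<close>

lemma no_global_Riccati_supersolution:
  fixes v v' :: "real \<Rightarrow> real"
  assumes v: "\<And>t. (v has_real_derivative v' t) (at t)"
  obtains t where "v' t < 1 + (v t)\<^sup>2"
proof (rule ccontr)
  assume "\<not> thesis"
  with that have ge: "\<And>t. 1 + (v t)\<^sup>2 \<le> v' t" by (meson not_le)
  have deriv: "((\<lambda>t. arctan (v t) - t) has_real_derivative v' t / (1 + (v t)\<^sup>2) - 1) (at t)" for t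
    by (auto intro!: derivative_eq_intros v simp: divide_inverse)
  have "0 \<le> v' t / (1 + (v t)\<^sup>2) - 1" for t
    using ge[of t] by (simp add: pos_le_divide_eq add_pos_nonneg)
  with deriv have "\<exists>y. ((\<lambda>t. arctan (v t) - t) has_real_derivative y) (at t) \<and> 0 \<le> y" for t
    by blast
  then have "arctan (v 0) - 0 \<le> arctan (v pi) - pi"
    by (intro DERIV_nonneg_imp_nondecreasing[where f = "\<lambda>t. arctan (v t) - t"] pi_ge_zero)
  with arctan_bounded[of "v 0"] arctan_bounded[of "v pi"] show False by simp
qed

theorem theorem1p3:
  assumes "CARD('n::finite) \<ge> 2"
  shows "\<not> (\<exists>u :: real^'n \<Rightarrow> real. smooth_on UNIV u \<and>
           Q_translator (CARD('n) - 1) (0, 1) (graph_param u) (upward_normal u) \<and>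
           (\<forall>x. \<exists>\<kappa>. principal_curvatures (graph_param u) (upward_normal u) x \<kappa> \<and> \<kappa> \<in> Gamma_cone))"
proof
  assume "\<exists>u :: real^'n \<Rightarrow> real. smooth_on UNIV u \<and>
           Q_translator (CARD('n) - 1) (0, 1) (graph_param u) (upward_normal u) \<and>
           (\<forall>x. \<exists>\<kappa>. principal_curvatures (graph_param u) (upward_normal u) x \<kappa> \<and> \<kappa> \<in> Gamma_cone)"
  then obtain u :: "real^'n \<Rightarrow> real" where u: "smooth_on UNIV u"
    "Q_translator (CARD('n) - 1) (0, 1) (graph_param u) (upward_normal u)"
    "\<And>x. \<exists>\<kappa>. principal_curvatures (graph_param u) (upward_normal u) x \<kappa> \<and> \<kappa> \<in> Gamma_cone"
    by blast
  fix k :: 'n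
  let ?line = "\<lambda>t. 0 + t *\<^sub>R axis k 1 :: real^'n"
  have "Ck_on 2 u UNIV" using u(1) by (simp add: smooth_on_def)
  then have "partial_deriv k u differentiable (at x)" for x
    by (simp add: numeral_2_eq_2 partial_deriv_def[abs_def])
  from has_real_derivative_along_line[OF this]
  have "((\<lambda>t. partial_deriv k u (?line t)) has_real_derivative
      partial_deriv k (partial_deriv k u) (?line t)) (at t)" for t
    unfolding partial_deriv_def[of k "partial_deriv k u"] by blast
  then obtain t where "partial_deriv k (partial_deriv k u) (?line t) < 1 + (partial_deriv k u (?line t))\<^sup>2"
    by (rule no_global_Riccati_supersolution)
  with translator_pure_second_derivative_bound[OF u] show False by (meson not_le)
qed

end
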